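(* Let $a,b,m\in\mathbb{N}$ with $a\ge b$. If $a\equiv b\pmod m$, then $F_{a,b,m}(q)\in\mathbb{N}_0[[q]]$. More precisely, if $a=b+tm$ (with $t\in\mathbb{N}_0$), then $$F_{a,b,m}(q)=\frac{(-q^{a+b};q^m)_\infty}{(q^b;q^m)_t\,(q^{2a};q^{2m})_\infty}\in\mathbb{N}_0[[q]].$$
   Context: $\mathbb{N}$ is the set of positive integers and $\mathbb{N}_0=\mathbb{N}\cup\{0\}$. Notation: $(z;q)_n=\prod_{i=0}^{n-1}(1-zq^i)$ and $(z;q)_\infty=\prod_{i\ge0}(1-zq^i)$. For $a,b,m\in\mathbb{N}$, $$F_{a,b,m}(q):=\frac{(-q^{a+b};q^m)_\infty}{(-q^a;q^m)_\infty\,(q^b;q^m)_\infty},$$ regarded as a formal power series in $q$. $\mathbb{N}_0[[q]]$ is the set of power series with non-negative integer coefficients. *)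

theory Defs
  imports "HOL-Analysis.Analysis" "HOL-Number_Theory.Cong"
begin

definition qpoch :: "'a :: comm_ring_1 \<Rightarrow> 'a \<Rightarrow> nat \<Rightarrow> 'a" where
  "qpoch z q n = (\<Prod>i<n. 1 - z * q ^ i)"

text \<open>
  The infinite product is taken in the metric topology of formal power series, in which
  a sequence converges iff each of its coefficients is eventually constant.
  The lemma \<open>qpoch_inf_has_prod\<close> below shows that it converges in all cases used here.
\<close>

definition qpoch_inf :: "'a :: comm_ring_1 fps \<Rightarrow> 'a fps \<Rightarrow> 'a fps" where
  "qpoch_inf z q = (\<Prod>i. 1 - z * q ^ i)"

text \<open>
  The coefficients are rational only so that division of power series is available. All
  denominators have constant coefficient 1, so the quotients are genuine.
\<close>

definition F :: "nat \<Rightarrow> nat \<Rightarrow> nat \<Rightarrow> rat fps" where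
  "F a b m = qpoch_inf (- (fps_X ^ (a + b))) (fps_X ^ m) /
     (qpoch_inf (- (fps_X ^ a)) (fps_X ^ m) * qpoch_inf (fps_X ^ b) (fps_X ^ m))"

definition nonneg_int_fps :: "rat fps set" where
  "nonneg_int_fps = {f. \<forall>n. fps_nth f n \<in> \<nat>}"

lemma qpoch_inf_has_prod:
  fixes z q :: "'a :: idom fps"
  assumes z: "fps_nth z 0 = 0" and q: "fps_nth q 0 = 0"
  shows "(\<lambda>i. 1 - z * q ^ i) has_prod qpoch_inf z q"
    and "fps_nth (qpoch_inf z q) 0 = 1"
proof -
  define f where "f = (\<lambda>i. 1 - z * q ^ i)"
  define P where "P = (\<lambda>n. \<Prod>i\<le>n. f i)"
  define G where "G = Abs_fps (\<lambda>k. fps_nth (P k) k)"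
  have low: "fps_nth (q ^ i) k = 0" if "k < i" for i k
    using startsby_zero_power_prefix[OF q] that by blast
  have zq: "fps_nth (z * q ^ i) k = 0" if "k \<le> i" for i k
    unfolding fps_mult_nth
  proof (rule sum.neutral, rule ballI)
    fix j assume j: "j \<in> {0..k}"
    show "fps_nth z j * fps_nth (q ^ i) (k - j) = 0"
    proof (cases "j = 0")
      case False
      with j that have "k - j < i" by auto
      with low show ?thesis by simp
    qed (simp add: z)
  qed
  have step: "fps_nth (P (Suc n)) k = fps_nth (P n) k" if "k \<le> n" for n k
  proof -
    have "P (Suc n) = P n - P n * (z * q ^ Suc n)"
      by (simp add: P_def f_def right_diff_distrib del: power_Suc)
    moreover have "fps_nth (P n * (z * q ^ Suc n)) k = 0"
    proof (subst fps_mult_nth, rule sum.neutral, rule ballI)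
      fix j assume "j \<in> {0..k}"
      with that have "k - j \<le> Suc n" by auto
      thus "fps_nth (P n) j * fps_nth (z * q ^ Suc n) (k - j) = 0"
        by (simp only: zq mult_zero_right)
    qed
    ultimately show ?thesis by (simp only: fps_sub_nth diff_zero)
  qed
  have stable: "fps_nth (P n) k = fps_nth (P k) k" if "k \<le> n" for n k
    using that by (induction n rule: dec_induct) (auto simp: step)
  have lim: "P \<longlonglongrightarrow> G"
  proof (rule tendsto_fpsI)
    fix k show "eventually (\<lambda>n. fps_nth (P n) k = fps_nth G k) sequentially"
      unfolding G_def fps_nth_Abs_fps using eventually_ge_at_top[of k] by eventually_elim (rule stable)
  qed
  have G0: "fps_nth G 0 = 1"
    by (simp add: G_def P_def f_def z)
  hence "G \<noteq> 0" by auto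
  with lim have "f has_prod G"
    by (simp add: has_prod_def raw_has_prod_def P_def)
  moreover from this have "qpoch_inf z q = G"
    using has_prod_unique[of f G] by (simp add: qpoch_inf_def f_def)
  ultimately show "(\<lambda>i. 1 - z * q ^ i) has_prod qpoch_inf z q"
    and "fps_nth (qpoch_inf z q) 0 = 1"
    using G0 by (simp_all add: f_def)
qed

end

theory Submission
  imports Defs
begin

text \<open>
  The difference of squares \<open>(1 + q\<^sup>k) (1 - q\<^sup>k) = 1 - q\<^sup>2\<^sup>k\<close> turns \<open>(-q\<^sup>a;q\<^sup>m)\<^sub>\<infinity> (q\<^sup>a;q\<^sup>m)\<^sub>\<infinity>\<close> into
  \<open>(q\<^sup>2\<^sup>a;q\<^sup>2\<^sup>m)\<^sub>\<infinity>\<close>. As \<open>a = b + t m\<close>, the factor \<open>(q\<^sup>a;q\<^sup>m)\<^sub>\<infinity>\<close> is the tail of \<open>(q\<^sup>b;q\<^sup>m)\<^sub>\<infinity>\<close>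
  left after its first \<open>t\<close> factors. The resulting quotient is a limit of products of factors
  \<open>1 + q\<^sup>k\<close> and \<open>1 / (1 - q\<^sup>k)\<close>, all of which have coefficients in \<open>\<nat>\<close>.
\<close>

lemma Nats_sum: "(\<And>i. i \<in> A \<Longrightarrow> f i \<in> \<nat>) \<Longrightarrow> sum f A \<in> \<nat>"
  by (induction A rule: infinite_finite_induct) auto

lemma nonneg_int_fps_1: "1 \<in> nonneg_int_fps"
  by (simp add: nonneg_int_fps_def)

lemma nonneg_int_fps_add: "f \<in> nonneg_int_fps \<Longrightarrow> g \<in> nonneg_int_fps \<Longrightarrow> f + g \<in> nonneg_int_fps"
  by (simp add: nonneg_int_fps_def)

lemma nonneg_int_fps_mult: "f \<in> nonneg_int_fps \<Longrightarrow> g \<in> nonneg_int_fps \<Longrightarrow> f * g \<in> nonneg_int_fps"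
  by (auto simp: nonneg_int_fps_def fps_mult_nth intro!: Nats_sum)

lemma nonneg_int_fps_prod:
  "(\<And>i. i \<in> A \<Longrightarrow> f i \<in> nonneg_int_fps) \<Longrightarrow> prod f A \<in> nonneg_int_fps"
  by (induction A rule: infinite_finite_induct) (auto intro: nonneg_int_fps_1 nonneg_int_fps_mult)

lemma nonneg_int_fps_X_power: "fps_X ^ k \<in> nonneg_int_fps"
  by (simp add: nonneg_int_fps_def)

text \<open>The inverse \<open>f\<close> satisfies \<open>f = 1 + f * h\<close>. As \<open>h\<close>
  has no constant term, this is a recursion that builds each coefficient of \<open>f\<close> from
  earlier ones by sums and products only.\<close>

lemma nonneg_int_fps_inverse_one_minus:
  assumes h: "h \<in> nonneg_int_fps" and h0: "fps_nth h 0 = 0"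
  shows "inverse (1 - h) \<in> nonneg_int_fps"
proof -
  define f where "f = inverse (1 - h)"
  have "f * (1 - h) = 1"
    unfolding f_def by (rule inverse_mult_eq_1) (simp add: h0)
  hence eq: "f = 1 + f * h"
    by (simp add: algebra_simps)
  have "fps_nth f n \<in> \<nat>" for n
  proof (induction n rule: less_induct)
    case (less n)
    have "fps_nth f n = fps_nth 1 n + fps_nth (f * h) n"
      by (subst eq) (simp only: fps_add_nth)
    also have "\<dots> \<in> \<nat>"
    proof (rule Nats_add)
      have "fps_nth f i * fps_nth h (n - i) \<in> \<nat>" if "i \<le> n" for i
        \<comment> \<open>For \<open>i = n\<close> the induction hypothesis says nothing, but then
          the factor \<open>fps_nth h 0\<close> vanishes.\<close>
        using less[of i] that h h0 by (cases "i = n") (auto simp: nonneg_int_fps_def)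
      thus "fps_nth (f * h) n \<in> \<nat>"
        by (auto simp: fps_mult_nth intro!: Nats_sum)
    qed simp
    finally show ?case .
  qed
  thus ?thesis
    by (simp add: nonneg_int_fps_def f_def)
qed

text \<open>Each coefficient of the limit already occurs as a coefficient of some member of the
  sequence. This carries nonnegativity from finite to infinite products.\<close>

lemma nonneg_int_fps_closed:
  assumes lim: "f \<longlonglongrightarrow> g" and f: "\<And>n. f n \<in> nonneg_int_fps"
  shows "g \<in> nonneg_int_fps"
proof -
  have "fps_nth g k \<in> \<nat>" for k
  proof -
    have "eventually (\<lambda>n. fps_nth (f n) k = fps_nth g k) sequentially"
      using lim by (simp add: tendsto_fps_iff)
    then obtain n where "fps_nth (f n) k = fps_nth g k"
      by (auto simp: eventually_sequentially)
    with f[of n] show ?thesis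
      by (metis (mono_tags, lifting) mem_Collect_eq nonneg_int_fps_def)
  qed
  thus ?thesis by (simp add: nonneg_int_fps_def)
qed

text \<open>Coefficient \<open>n\<close> of a product depends only on the coefficients up to
  \<open>n\<close> of the factors, and these finitely many are eventually constant together.\<close>

lemma tendsto_mult_fps:
  fixes f g :: "'b \<Rightarrow> 'a :: ring_1 fps"
  assumes "(f \<longlongrightarrow> f') \<F>" and "(g \<longlongrightarrow> g') \<F>"
  shows "((\<lambda>x. f x * g x) \<longlongrightarrow> f' * g') \<F>"
proof (rule tendsto_fpsI)
  fix n
  have "eventually (\<lambda>x. \<forall>i\<in>{..n}. fps_nth (f x) i = fps_nth f' i \<and> fps_nth (g x) i = fps_nth g' i) \<F>"
    using assms by (intro eventually_ball_finite) (auto simp: tendsto_fps_iff eventually_conj_iff)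
  thus "eventually (\<lambda>x. fps_nth (f x * g x) n = fps_nth (f' * g') n) \<F>"
    by eventually_elim (auto simp: fps_mult_nth intro!: sum.cong)
qed

lemma qpoch_tendsto_qpoch_inf:
  fixes z q :: "'a :: idom fps"
  assumes "fps_nth z 0 = 0" and "fps_nth q 0 = 0"
  shows "qpoch z q \<longlonglongrightarrow> qpoch_inf z q"
  using has_prod_imp_tendsto'[OF qpoch_inf_has_prod(1)[OF assms]] by (simp add: qpoch_def[abs_def])

lemma qpoch_add: "qpoch z q (n + t) = qpoch z q t * qpoch (z * q ^ t) q n"
  by (induction n) (simp_all add: qpoch_def power_add mult_ac)

text \<open>Both sides are limits of the same shifted sequence of partial products, by
  \<open>qpoch_add\<close>.\<close>

lemma qpoch_inf_split:
  fixes z q :: "'a :: idom fps"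
  assumes z: "fps_nth z 0 = 0" and q: "fps_nth q 0 = 0"
  shows "qpoch_inf z q = qpoch z q t * qpoch_inf (z * q ^ t) q"
proof (rule LIMSEQ_unique)
  show "(\<lambda>n. qpoch z q (n + t)) \<longlonglongrightarrow> qpoch_inf z q"
    by (rule LIMSEQ_ignore_initial_segment[OF qpoch_tendsto_qpoch_inf[OF z q]])
  show "(\<lambda>n. qpoch z q (n + t)) \<longlonglongrightarrow> qpoch z q t * qpoch_inf (z * q ^ t) q"
    unfolding qpoch_add by (intro tendsto_mult_fps tendsto_const qpoch_tendsto_qpoch_inf) (simp_all add: z q)
qed

lemma qpoch_minus_mult: "qpoch (- z) q n * qpoch z q n = qpoch (z\<^sup>2) (q\<^sup>2) n"
  unfolding qpoch_def prod.distrib[symmetric]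
  by (intro prod.cong refl) (simp add: algebra_simps power2_eq_square power_mult_distrib)

lemma qpoch_inf_minus_mult:
  fixes z q :: "'a :: idom fps"
  assumes z: "fps_nth z 0 = 0" and q: "fps_nth q 0 = 0"
  shows "qpoch_inf (- z) q * qpoch_inf z q = qpoch_inf (z\<^sup>2) (q\<^sup>2)"
proof (rule LIMSEQ_unique)
  show "(\<lambda>n. qpoch (- z) q n * qpoch z q n) \<longlonglongrightarrow> qpoch_inf (- z) q * qpoch_inf z q"
    by (intro tendsto_mult_fps qpoch_tendsto_qpoch_inf) (simp_all add: z q)
  show "(\<lambda>n. qpoch (- z) q n * qpoch z q n) \<longlonglongrightarrow> qpoch_inf (z\<^sup>2) (q\<^sup>2)"
    unfolding qpoch_minus_mult by (intro qpoch_tendsto_qpoch_inf) (simp_all add: power2_eq_square z q)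
qed

text \<open>The two minus signs cancel, so every factor has the form
  \<open>1 + fps_X ^ j\<close>.\<close>

lemma qpoch_inf_minus_X_nonneg:
  assumes "k > 0" and "m > 0"
  shows "qpoch_inf (- (fps_X ^ k)) (fps_X ^ m) \<in> nonneg_int_fps"
proof (rule nonneg_int_fps_closed[OF qpoch_tendsto_qpoch_inf])
  show "qpoch (- (fps_X ^ k)) (fps_X ^ m) n \<in> nonneg_int_fps" for n
    unfolding qpoch_def
    by (intro nonneg_int_fps_prod)
       (auto intro!: nonneg_int_fps_add nonneg_int_fps_mult nonneg_int_fps_1 nonneg_int_fps_X_power
             simp flip: power_mult)
qed (use assms in \<open>simp_all add: fps_X_power_nth\<close>)

lemma inverse_qpoch_X_nonneg:
  assumes "k > 0"
  shows "inverse (qpoch (fps_X ^ k) (fps_X ^ m) n) \<in> nonneg_int_fps"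
  unfolding qpoch_def inverse_prod_fps
  by (intro nonneg_int_fps_prod nonneg_int_fps_inverse_one_minus)
     (use assms in \<open>simp_all add: nonneg_int_fps_X_power flip: power_mult power_add\<close>)

text \<open>Inversion is continuous here because the limit has constant coefficient 1, so the finite
  case passes to the limit.\<close>

lemma inverse_qpoch_inf_X_nonneg:
  assumes "k > 0" and "m > 0"
  shows "inverse (qpoch_inf (fps_X ^ k) (fps_X ^ m)) \<in> nonneg_int_fps"
proof (rule nonneg_int_fps_closed)
  have *: "fps_nth (fps_X ^ k :: rat fps) 0 = 0" "fps_nth (fps_X ^ m :: rat fps) 0 = 0"
    using assms by simp_all
  show "(\<lambda>n. inverse (qpoch (fps_X ^ k) (fps_X ^ m) n)) \<longlonglongrightarrow>
          inverse (qpoch_inf (fps_X ^ k) (fps_X ^ m) :: rat fps)"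
    by (rule tendsto_inverse_fps[OF qpoch_tendsto_qpoch_inf[OF *]])
       (simp add: qpoch_inf_has_prod(2)[OF *])
qed (use assms in \<open>simp add: inverse_qpoch_X_nonneg\<close>)

lemma F_eq:
  assumes "a > 0" and "b > 0" and "m > 0" and "a = b + t * m"
  shows "F a b m = qpoch_inf (- (fps_X ^ (a + b))) (fps_X ^ m) /
    (qpoch (fps_X ^ b) (fps_X ^ m) t * qpoch_inf (fps_X ^ (2 * a)) (fps_X ^ (2 * m)))"
proof -
  let ?X = "fps_X :: rat fps"
  have "qpoch_inf (?X ^ b) (?X ^ m) = qpoch (?X ^ b) (?X ^ m) t * qpoch_inf (?X ^ b * (?X ^ m) ^ t) (?X ^ m)"
    by (rule qpoch_inf_split) (use assms in simp_all)
  \<comment> \<open>This is where \<open>a = b + t * m\<close> enters: the tail left after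
    \<open>t\<close> factors starts exactly at exponent \<open>a\<close>.\<close>
  also have "?X ^ b * (?X ^ m) ^ t = ?X ^ a"
    by (simp add: assms(4) mult.commute flip: power_mult power_add)
  finally have "qpoch_inf (- (?X ^ a)) (?X ^ m) * qpoch_inf (?X ^ b) (?X ^ m) =
      qpoch (?X ^ b) (?X ^ m) t * (qpoch_inf (- (?X ^ a)) (?X ^ m) * qpoch_inf (?X ^ a) (?X ^ m))"
    by (simp only: mult_ac)
  also have "qpoch_inf (- (?X ^ a)) (?X ^ m) * qpoch_inf (?X ^ a) (?X ^ m) =
      qpoch_inf (?X ^ (2 * a)) (?X ^ (2 * m))"
    using qpoch_inf_minus_mult[of "?X ^ a" "?X ^ m"] assms(1,3)
    by (simp add: mult.commute flip: power_mult)
  finally show ?thesis by (simp only: F_def)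
qed

text \<open>The denominator has constant coefficient 1, so division is multiplication by its
  inverse, which splits into the two inverses treated above.\<close>

lemma quotient_nonneg:
  assumes "a > 0" and "b > 0" and "m > 0"
  shows "qpoch_inf (- (fps_X ^ (a + b))) (fps_X ^ m) /
    (qpoch (fps_X ^ b) (fps_X ^ m) t * qpoch_inf (fps_X ^ (2 * a)) (fps_X ^ (2 * m)))
      \<in> nonneg_int_fps"
proof -
  have "fps_nth (qpoch (fps_X ^ b) (fps_X ^ m) t :: rat fps) 0 = 1"
    using assms by (simp add: qpoch_def fps_prod_nth')
  moreover have "fps_nth (qpoch_inf (fps_X ^ (2 * a)) (fps_X ^ (2 * m)) :: rat fps) 0 = 1"
    by (rule qpoch_inf_has_prod(2)) (use assms in simp_all)
  ultimately show ?thesis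
    using assms
    by (subst fps_divide_unit)
       (auto simp: fps_inverse_mult intro!: nonneg_int_fps_mult qpoch_inf_minus_X_nonneg
             inverse_qpoch_X_nonneg inverse_qpoch_inf_X_nonneg)
qed

theorem theorem1p6:
  fixes a b m :: nat
  assumes "a > 0" and "b > 0" and "m > 0" and "a \<ge> b"
  shows "([a = b] (mod m) \<longrightarrow> F a b m \<in> nonneg_int_fps) \<and>
    (\<forall>t::nat. a = b + t * m \<longrightarrow>
       F a b m = qpoch_inf (- (fps_X ^ (a + b))) (fps_X ^ m) /
         (qpoch (fps_X ^ b) (fps_X ^ m) t * qpoch_inf (fps_X ^ (2 * a)) (fps_X ^ (2 * m))) \<and>
       qpoch_inf (- (fps_X ^ (a + b))) (fps_X ^ m) /
         (qpoch (fps_X ^ b) (fps_X ^ m) t * qpoch_inf (fps_X ^ (2 * a)) (fps_X ^ (2 * m)))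
         \<in> nonneg_int_fps)"
proof (intro conjI impI allI)
  assume "[a = b] (mod m)"
  \<comment> \<open>The assumption \<open>a \<ge> b\<close> makes the multiplier in the congruence a
    natural number.\<close>
  then obtain t where "a = b + t * m"
    using \<open>a \<ge> b\<close> by (metis cong_sym_eq cong_le_nat mult.commute add.commute)
  thus "F a b m \<in> nonneg_int_fps"
    using F_eq[of a b m t] quotient_nonneg[of a b m t] assms by simp
qed (use assms in \<open>blast intro: F_eq quotient_nonneg\<close>)+

end
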